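(* Let $V$ be the four dimensional real vector space with ordered basis $(e_1,f_1,e_2,f_2)$. Let $N_1,N_2$ be the nilpotent endomorphisms of $V$ given by $$N_1(e_1)=f_1,\quad N_1(f_1)=0,\quad N_1(e_2)=f_2,\quad N_1(f_2)=0,$$ $$N_2(e_1)=f_2,\quad N_2(f_1)=0,\quad N_2(e_2)=0,\quad N_2(f_2)=0.$$ Let $W$ be the increasing filtration of $V$ with $\mathrm{gr}^W_kV=0$ for $k\ne1$, and let $F$ be the decreasing filtration of $V_{\mathbb C}=V\otimes\mathbb C$ with $\mathrm{gr}_F^kV_{\mathbb C}=0$ for $k\notin[0,1]$ and $F^1=\langle e_1,e_2\rangle$. Then $(V,W,N_1,N_2;F)$ is a Deligne--Hodge system in two variables (an object of $\mathrm{DH}_2$).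
   Context: For a nilpotent endomorphism $N$ preserving an increasing filtration $W$, the relative weight filtration $M=M(N,W)$ is the increasing filtration (unique if it exists) such that $N(M_k)\subseteq M_{k-2}$ for all $k$ and $N^\ell: Gr^M_{k+\ell}Gr^W_k\to Gr^M_{k-\ell}Gr^W_k$ is an isomorphism for all $k$ and all $\ell\ge 0$. A Deligne--Hodge system in $r$ variables (object of $\mathrm{DH}_r$) $(V,W,N_1,\dots,N_r;F)$ consists of a finite dimensional complex vector space with real structure, $V_{\mathbb C}=V_{\mathbb R}\otimes\mathbb C$, an increasing filtration $W=W^0$ and endomorphisms $N_1,\dots,N_r$, all defined over $\mathbb R$, and a decreasing filtration $F$ of $V_{\mathbb C}$, such that: (a) $N_1,\dots,N_r$ are commuting nilpotent endomorphisms preserving $W^0$; (b) $W^j:=M(N_j,W^{j-1})$ exists for $j=1,\dots,r$; (c) for $1\le j\le r$, $0\le k<j-1$, $\ell\in\mathbb Z$ and $U=W^k_\ell$, the filtration $W^j|_U$ is the relative weight filtration of $N_j|_U$ with respect to $W^{j-1}|_U$; (d) $N_j(W^k_\ell)\subseteq W^k_\ell$ for all $j,k,\ell$, and $N_j(W^k_\ell)\subseteq W^k_{\ell-2}$ if $k\ge j$; (f1) $N_jF^p\subset F^{p-1}$ for all $j,p$; (f2) $(F,W^r)$ is a mixed Hodge structure, and for $0\le k<r$, $\ell\in\mathbb Z$ and $U=W^k_\ell$, $(F|_U,W^r|_U)$ is a mixed Hodge structure. *)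

theory Defs
  imports "HOL-Analysis.Analysis" "HOL-Library.Set_Algebras"
begin

section \<open>Complexification of a real vector space\<close>

text \<open>The complexification of a real vector space \<open>'v\<close> is the type \<open>'v \<times> 'v\<close>, the pair \<open>(x, y)\<close>
  standing for \<open>x \<otimes> 1 + y \<otimes> \<i>\<close>; so \<open>x\<close> in \<open>'v\<close> is identified with \<open>(x, 0)\<close>.\<close>

definition cscale :: "complex \<Rightarrow> 'v::real_vector \<times> 'v \<Rightarrow> 'v \<times> 'v" where
  "cscale c z = (Re c *\<^sub>R fst z - Im c *\<^sub>R snd z, Re c *\<^sub>R snd z + Im c *\<^sub>R fst z)"

global_interpretation cx: vector_space cscale
  by standard (auto simp: cscale_def algebra_simps)

definition cconj :: "'v::real_vector \<times> 'v \<Rightarrow> 'v \<times> 'v" where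
  "cconj z = (fst z, - snd z)"

definition complexify :: "'v::real_vector set \<Rightarrow> ('v \<times> 'v) set" where
  "complexify U = U \<times> U"

section \<open>Filtrations and graded pieces\<close>

text \<open>Filtrations are indexed by the integers and finite (hence separated and exhaustive).\<close>

definition increasing_filtration :: "'v::real_vector set \<Rightarrow> (int \<Rightarrow> 'v set) \<Rightarrow> bool" where
  "increasing_filtration U W \<longleftrightarrow>
     (\<forall>k. subspace (W k)) \<and> mono W \<and>
     (\<exists>a. \<forall>k\<le>a. W k = {0}) \<and> (\<exists>b. \<forall>k\<ge>b. W k = U)"

definition decreasing_filtration :: "('v::real_vector \<times> 'v) set \<Rightarrow> (int \<Rightarrow> ('v \<times> 'v) set) \<Rightarrow> bool" where
  "decreasing_filtration H F \<longleftrightarrow>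
     (\<forall>p. cx.subspace (F p)) \<and> antimono F \<and>
     (\<exists>a. \<forall>p\<le>a. F p = H) \<and> (\<exists>b. \<forall>p\<ge>b. F p = {0})"

text \<open>\<open>cosets B A\<close> is the set of classes modulo \<open>B\<close> of the elements of \<open>A\<close>: the quotient \<open>A/B\<close> if
  \<open>B \<subseteq> A\<close>, and for \<open>A, B \<subseteq> C\<close> the image of \<open>A\<close> in \<open>C/B\<close>. The zero element of \<open>A/B\<close> is \<open>B\<close>, and
  the sum of two classes is their sum as sets. As sets of vectors again form an additive monoid,
  \<open>cosets\<close> can be iterated to form quotients of quotients.\<close>

definition cosets :: "'a::plus set \<Rightarrow> 'a set \<Rightarrow> 'a set set" where
  "cosets B A = (\<lambda>x. x +o B) ` A"

definition gr_inc :: "(int \<Rightarrow> 'a::plus set) \<Rightarrow> int \<Rightarrow> 'a set set" where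
  "gr_inc W k = cosets (W (k - 1)) (W k)"

definition gr_dec :: "(int \<Rightarrow> 'a::plus set) \<Rightarrow> int \<Rightarrow> 'a set set" where
  "gr_dec F p = cosets (F (p + 1)) (F p)"

text \<open>The filtration induced by \<open>M\<close> on \<open>gr_inc W k\<close>.\<close>

definition induced :: "(int \<Rightarrow> 'a::plus set) \<Rightarrow> (int \<Rightarrow> 'a set) \<Rightarrow> int \<Rightarrow> int \<Rightarrow> 'a set set" where
  "induced M W k j = cosets (W (k - 1)) (M j \<inter> W k)"

section \<open>Relative weight filtrations\<close>

text \<open>\<open>gr_class M W k j x\<close> is the class of \<open>x \<in> M j \<inter> W k\<close> in the \<open>j\<close>-th graded piece, for the filtration
  induced by \<open>M\<close>, of \<open>gr_inc W k\<close>.\<close>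

definition gr_class ::
  "(int \<Rightarrow> 'a::plus set) \<Rightarrow> (int \<Rightarrow> 'a set) \<Rightarrow> int \<Rightarrow> int \<Rightarrow> 'a \<Rightarrow> 'a set set" where
  "gr_class M W k j x = (x +o W (k - 1)) +o induced M W k (j - 1)"

text \<open>\<open>M\<close> is the relative weight filtration of the nilpotent endomorphism \<open>N\<close> of the space \<open>U\<close> with
  respect to \<open>W\<close>. The function \<open>\<phi>\<close> is the map induced by the \<open>l\<close>-th power of \<open>N\<close>; it is determined on its
  domain by its values on classes, and is automatically linear.\<close>

definition is_relative_weight_filtration ::
  "'v::real_vector set \<Rightarrow> ('v \<Rightarrow> 'v) \<Rightarrow> (int \<Rightarrow> 'v set) \<Rightarrow> (int \<Rightarrow> 'v set) \<Rightarrow> bool" where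
  "is_relative_weight_filtration U N W M \<longleftrightarrow>
     linear N \<and> N ` U \<subseteq> U \<and> (\<exists>n. \<forall>x\<in>U. (N ^^ n) x = 0) \<and>
     increasing_filtration U W \<and> (\<forall>k. N ` W k \<subseteq> W k) \<and>
     increasing_filtration U M \<and> (\<forall>k. N ` M k \<subseteq> M (k - 2)) \<and>
     (\<forall>k. \<forall>l::nat. \<exists>\<phi>.
        bij_betw \<phi> (gr_inc (induced M W k) (k + int l)) (gr_inc (induced M W k) (k - int l)) \<and>
        (\<forall>x \<in> M (k + int l) \<inter> W k.
           \<phi> (gr_class M W k (k + int l) x) = gr_class M W k (k - int l) ((N ^^ l) x)))"

section \<open>Mixed Hodge structures\<close>

text \<open>The filtration \<open>F\<close> of \<open>H\<close> is \<open>n\<close>-opposed to its conjugate, that is, \<open>H\<close> is the direct sum of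
  \<open>F p\<close> and the conjugate of \<open>F (n + 1 - p)\<close> for all \<open>p\<close>. Since \<open>H\<close> will be a quotient, its zero element
  \<open>z\<close> and its conjugation \<open>\<sigma>\<close> are parameters.\<close>

definition pure_hodge ::
  "int \<Rightarrow> 'a::plus set \<Rightarrow> 'a \<Rightarrow> ('a \<Rightarrow> 'a) \<Rightarrow> (int \<Rightarrow> 'a set) \<Rightarrow> bool" where
  "pure_hodge n H z \<sigma> F \<longleftrightarrow>
     (\<forall>p. F p + \<sigma> ` F (n + 1 - p) = H \<and> F p \<inter> \<sigma> ` F (n + 1 - p) = {z})"

definition mixed_hodge_structure ::
  "'v::real_vector set \<Rightarrow> (int \<Rightarrow> ('v \<times> 'v) set) \<Rightarrow> (int \<Rightarrow> 'v set) \<Rightarrow> bool" where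
  "mixed_hodge_structure U F W \<longleftrightarrow>
     increasing_filtration U W \<and> decreasing_filtration (complexify U) F \<and>
     (\<forall>k. let WC = (\<lambda>k. complexify (W k)) in
        pure_hodge k (gr_inc WC k) (WC (k - 1)) (image cconj) (induced F WC k))"

section \<open>Deligne--Hodge systems\<close>

text \<open>The real vector space underlying the system is the type \<open>'v\<close>. The endomorphisms are \<open>N j\<close> for
  \<open>1 \<le> j \<le> r\<close>; other values of \<open>N\<close> are irrelevant. \<open>Ws j\<close> is the filtration obtained after \<open>j\<close> steps; relative
  weight filtrations being unique, \<open>Ws\<close> is determined by \<open>W\<close> and \<open>N\<close> for indices up to \<open>r\<close>. On the
  complexification, \<open>N j\<close> acts as \<open>map_prod (N j) (N j)\<close>.\<close>

definition restrict_fil :: "(int \<Rightarrow> 'a set) \<Rightarrow> 'a set \<Rightarrow> int \<Rightarrow> 'a set" where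
  "restrict_fil W U k = W k \<inter> U"

definition deligne_hodge_system ::
  "nat \<Rightarrow> (int \<Rightarrow> 'v::real_vector set) \<Rightarrow> (nat \<Rightarrow> 'v \<Rightarrow> 'v) \<Rightarrow> (int \<Rightarrow> ('v \<times> 'v) set) \<Rightarrow> bool" where
  "deligne_hodge_system r W N F \<longleftrightarrow>
     (\<exists>B::'v set. finite B \<and> span B = UNIV) \<and>
     increasing_filtration UNIV W \<and>
     decreasing_filtration UNIV F \<and>
     (\<forall>j\<in>{1..r}. linear (N j) \<and> (\<exists>n. \<forall>x. (N j ^^ n) x = 0) \<and> (\<forall>l. N j ` W l \<subseteq> W l)) \<and>
     (\<forall>i\<in>{1..r}. \<forall>j\<in>{1..r}. N i \<circ> N j = N j \<circ> N i) \<and>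
     (\<exists>Ws :: nat \<Rightarrow> int \<Rightarrow> 'v set.
        Ws 0 = W \<and>
        (\<forall>j\<in>{1..r}. is_relative_weight_filtration UNIV (N j) (Ws (j - 1)) (Ws j)) \<and>
        (\<forall>j\<in>{1..r}. \<forall>k l. k + 1 < j \<longrightarrow>
           is_relative_weight_filtration (Ws k l) (N j)
             (restrict_fil (Ws (j - 1)) (Ws k l)) (restrict_fil (Ws j) (Ws k l))) \<and>
        (\<forall>j\<in>{1..r}. \<forall>k\<in>{0..r}. \<forall>l. N j ` Ws k l \<subseteq> Ws k l) \<and>
        (\<forall>j\<in>{1..r}. \<forall>k\<in>{0..r}. \<forall>l. j \<le> k \<longrightarrow> N j ` Ws k l \<subseteq> Ws k (l - 2)) \<and>
        (\<forall>j\<in>{1..r}. \<forall>p. map_prod (N j) (N j) ` F p \<subseteq> F (p - 1)) \<and>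
        mixed_hodge_structure UNIV F (Ws r) \<and>
        (\<forall>k<r. \<forall>l. mixed_hodge_structure (Ws k l)
           (restrict_fil F (complexify (Ws k l))) (restrict_fil (Ws r) (Ws k l))))"

end

theory Submission
  imports Defs
begin

text \<open>
  The map \<open>N\<^sub>1\<close> has kernel and image \<open>L = \<langle>f\<^sub>1, f\<^sub>2\<rangle>\<close>, and \<open>W\<close> is pure of weight 1, so \<open>W\<^sup>1 = M(N\<^sub>1, W)\<close> is
  the monodromy weight filtration centred at 1: it has \<open>L\<close> in weight 0 and \<open>V/L\<close> in weight 2
  (\<open>relative_weight_filtration_pure\<close>). The map \<open>N\<^sub>2\<close> sends \<open>V\<close> into \<open>L\<close> and kills \<open>L\<close>, hence lowers
  \<open>W\<^sup>1\<close> by two and is zero on the graded pieces of \<open>W\<^sup>1\<close>. A relative weight filtration then has nothing to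
  add, and \<open>W\<^sup>2 = W\<^sup>1\<close> (\<open>relative_weight_filtration_self\<close>).

  For the Hodge condition, \<open>F\<^sup>1 = \<langle>e\<^sub>1, e\<^sub>2\<rangle>\<close> is a complement of \<open>L\<close>. Thus \<open>F\<close> induces on \<open>V/L\<close>, of weight
  2, only type \<open>(1,1)\<close>, and on \<open>L\<close>, of weight 0, only type \<open>(0,0)\<close>: the structure is of Hodge--Tate
  type. Opposedness is automatic for such filtrations (\<open>hodge_tate_imp_mixed_hodge\<close>), and the type is
  inherited by every step of the weight filtration (\<open>hodge_tate_restrict\<close>). This settles all the
  subspaces in question, because each step of \<open>W\<close>, \<open>W\<^sup>1\<close> and \<open>W\<^sup>2\<close> is a step of \<open>W\<^sup>2\<close>.
\<close>

section \<open>Cosets of subspaces\<close>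

lemma coset_eq_iff:
  fixes A :: "'a::real_vector set"
  assumes "subspace A"
  shows "x +o A = y +o A \<longleftrightarrow> x - y \<in> A"
proof
  assume eq: "x +o A = y +o A"
  have "x + 0 \<in> x +o A"
    using subspace_0[OF assms] by (rule set_plus_intro2)
  then show "x - y \<in> A"
    unfolding eq by (auto simp: elt_set_plus_def)
next
  have sub: "u +o A \<subseteq> v +o A" if d: "u - v \<in> A" for u v
  proof
    fix z assume "z \<in> u +o A"
    then obtain a where a: "a \<in> A" "z = u + a"
      by (auto simp: elt_set_plus_def)
    have "z = v + ((u - v) + a)"
      using a by simp
    moreover have "(u - v) + a \<in> A"
      using subspace_add[OF assms d a(1)] .
    ultimately show "z \<in> v +o A"
      unfolding elt_set_plus_def by blast
  qed
  assume d: "x - y \<in> A"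
  then have "y - x \<in> A"
    using subspace_neg[OF assms d] by simp
  with d show "x +o A = y +o A"
    using sub by blast
qed

lemma coset_add:
  fixes A :: "'a::real_vector set"
  assumes "subspace A"
  shows "(x +o A) + (y +o A) = (x + y) +o A"
proof
  show "(x +o A) + (y +o A) \<subseteq> (x + y) +o A"
  proof
    fix z assume "z \<in> (x +o A) + (y +o A)"
    then obtain a b where "a \<in> A" "b \<in> A" "z = (x + a) + (y + b)"
      by (auto simp: elt_set_plus_def set_plus_def)
    then show "z \<in> (x + y) +o A"
      using subspace_add[OF assms] by (auto simp: elt_set_plus_def algebra_simps)
  qed
  show "(x + y) +o A \<subseteq> (x +o A) + (y +o A)"
  proof
    fix z assume "z \<in> (x + y) +o A"
    then obtain a where "a \<in> A" "z = (x + a) + (y + 0)"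
      by (auto simp: elt_set_plus_def algebra_simps)
    then show "z \<in> (x +o A) + (y +o A)"
      using subspace_0[OF assms] by (blast intro: set_plus_intro set_plus_intro2)
  qed
qed

lemma coset_zero:
  fixes A :: "'a::real_vector set"
  shows "0 +o A = A"
  by (auto simp: elt_set_plus_def)

lemma cosets_trivial_imp_subset:
  fixes A :: "'a::real_vector set"
  assumes "0 \<in> B" "cosets B A = {B}"
  shows "A \<subseteq> B"
proof
  fix x assume "x \<in> A"
  then have "x +o B = B"
    using assms(2) by (auto simp: cosets_def)
  moreover have "x + 0 \<in> x +o B"
    using assms(1) by (rule set_plus_intro2)
  ultimately show "x \<in> B"
    by simp
qed

lemma subspace_complexify: "subspace U \<Longrightarrow> subspace (complexify U)"
  unfolding complexify_def by (rule subspace_Times)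

lemma cx_subspace_complexify: "subspace U \<Longrightarrow> cx.subspace (complexify U)"
  by (auto simp: cx.subspace_def complexify_def cscale_def mem_Times_iff zero_prod_def
      intro!: subspace_add subspace_diff subspace_scale dest: subspace_0)

lemma complexify_mono: "A \<subseteq> B \<Longrightarrow> complexify A \<subseteq> complexify B"
  by (auto simp: complexify_def)

lemma cconj_complexify: "subspace U \<Longrightarrow> z \<in> complexify U \<Longrightarrow> cconj z \<in> complexify U"
  by (auto simp: complexify_def cconj_def subspace_neg)

lemma cconj_cconj [simp]: "cconj (cconj z) = z"
  by (simp add: cconj_def)

lemma cconj_zero [simp]: "cconj 0 = 0"
  by (simp add: cconj_def zero_prod_def)

lemma cconj_add: "cconj (x + y) = cconj x + cconj y"
  by (simp add: cconj_def prod_eq_iff)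

lemma cconj_coset:
  assumes "subspace U"
  shows "cconj ` (x +o complexify U) = cconj x +o complexify U"
proof
  show "cconj ` (x +o complexify U) \<subseteq> cconj x +o complexify U"
    using cconj_complexify[OF assms] by (auto simp: elt_set_plus_def cconj_add)
  show "cconj x +o complexify U \<subseteq> cconj ` (x +o complexify U)"
  proof
    fix z assume "z \<in> cconj x +o complexify U"
    then obtain u where u: "u \<in> complexify U" "z = cconj x + u"
      by (auto simp: elt_set_plus_def)
    then have "z = cconj (x + cconj u)"
      by (simp add: cconj_add)
    then show "z \<in> cconj ` (x +o complexify U)"
      using cconj_complexify[OF assms u(1)] by (auto simp: elt_set_plus_def)
  qed
qed

section \<open>Relative weight filtrations\<close>

lemma gr_class_eq_iff:
  fixes M W :: "int \<Rightarrow> 'v::real_vector set"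
  assumes M: "\<And>j. subspace (M j)" and W: "\<And>k. subspace (W k)"
  shows "gr_class M W k j x = gr_class M W k j y \<longleftrightarrow>
    x - y \<in> (M (j - 1) \<inter> W k) + W (k - 1)"
proof -
  let ?A = "W (k - 1)" and ?B = "M (j - 1) \<inter> W k"
  have B: "subspace ?B"
    by (intro subspace_inter M W)
  have expand: "gr_class M W k j u = (\<lambda>z. (u + z) +o ?A) ` ?B" for u
    unfolding gr_class_def induced_def cosets_def
    by (auto simp: elt_set_plus_def[of "_ +o _"] coset_add[OF W])
  have sub: "gr_class M W k j u \<subseteq> gr_class M W k j v" if "u - v \<in> ?B + ?A" for u v
  proof -
    obtain b a where ab: "b \<in> ?B" "a \<in> ?A" "u - v = b + a"
      using \<open>u - v \<in> ?B + ?A\<close> by (rule set_plus_elim)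
    show ?thesis
      unfolding expand
    proof (rule image_subsetI)
      fix z assume z: "z \<in> ?B"
      have "(u + z) - (v + (b + z)) = a"
        using ab(3) by (simp add: algebra_simps)
      then have "(u + z) +o ?A = (v + (b + z)) +o ?A"
        using ab(2) by (simp only: coset_eq_iff[OF W])
      then show "(u + z) +o ?A \<in> (\<lambda>z. (v + z) +o ?A) ` ?B"
        using subspace_add[OF B ab(1) z] by blast
    qed
  qed
  show ?thesis
  proof
    assume eq: "gr_class M W k j x = gr_class M W k j y"
    have "(x + 0) +o ?A \<in> gr_class M W k j x"
      unfolding expand using subspace_0[OF B] by (rule imageI)
    then obtain z where z: "z \<in> ?B" "(x + 0) +o ?A = (y + z) +o ?A"
      unfolding eq unfolding expand by blast
    then have "(x + 0) - (y + z) \<in> ?A"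
      by (simp only: coset_eq_iff[OF W])
    then have "z + ((x + 0) - (y + z)) \<in> ?B + ?A"
      by (rule set_plus_intro[OF z(1)])
    then show "x - y \<in> ?B + ?A"
      by simp
  next
    assume d: "x - y \<in> ?B + ?A"
    then obtain b a where ba: "b \<in> ?B" "a \<in> ?A" "x - y = b + a"
      by (rule set_plus_elim)
    then have "- b + - a \<in> ?B + ?A"
      by (intro set_plus_intro subspace_neg[OF B] subspace_neg[OF W])
    moreover have "y - x = - b + - a"
      using ba(3) by (simp add: algebra_simps)
    ultimately have "y - x \<in> ?B + ?A"
      by simp
    then show "gr_class M W k j x = gr_class M W k j y"
      using sub d by (metis subset_antisym)
  qed
qed

lemma gr_inc_induced: "gr_inc (induced M W k) j = gr_class M W k j ` (M j \<inter> W k)"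
  by (auto simp: gr_inc_def gr_class_def induced_def cosets_def)

lemma bij_betw_classes:
  assumes maps: "\<And>x. x \<in> D \<Longrightarrow> g x \<in> D'"
    and kernel: "\<And>x y. x \<in> D \<Longrightarrow> y \<in> D \<Longrightarrow> c x = c y \<longleftrightarrow> c' (g x) = c' (g y)"
    and onto: "\<And>y. y \<in> D' \<Longrightarrow> \<exists>x\<in>D. c' (g x) = c' y"
  shows "\<exists>\<phi>. bij_betw \<phi> (c ` D) (c' ` D') \<and> (\<forall>x\<in>D. \<phi> (c x) = c' (g x))"
proof -
  define \<phi> where "\<phi> = (\<lambda>u. c' (g (inv_into D c u)))"
  have \<phi>: "\<phi> (c x) = c' (g x)" if "x \<in> D" for x
  proof -
    have "inv_into D c (c x) \<in> D" "c (inv_into D c (c x)) = c x"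
      using that by (auto intro: inv_into_into f_inv_into_f)
    then show ?thesis
      unfolding \<phi>_def using kernel that by blast
  qed
  have "inj_on \<phi> (c ` D)"
    using \<phi> kernel by (auto intro!: inj_onI)
  moreover have "\<phi> ` c ` D = c' ` D'"
  proof
    show "\<phi> ` c ` D \<subseteq> c' ` D'"
      using \<phi> maps by auto
    show "c' ` D' \<subseteq> \<phi> ` c ` D"
    proof (rule image_subsetI)
      fix y assume "y \<in> D'"
      then obtain x where "x \<in> D" "c' (g x) = c' y"
        using onto by blast
      then show "c' y \<in> \<phi> ` c ` D"
        using \<phi> by (metis imageI)
    qed
  qed
  ultimately show ?thesis
    using \<phi> by (auto simp: bij_betw_def)
qed

text \<open>A statement about iterated quotients becomes one about vectors: the linear map induced by \<open>N\<^sup>l\<close> is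
  well defined, injective and surjective, where a vector of \<open>M j \<inter> W k\<close> counts as zero if it lies in
  \<open>(M (j - 1) \<inter> W k) + W (k - 1)\<close>.\<close>

lemma gr_isomorphismI:
  fixes M W :: "int \<Rightarrow> 'v::real_vector set"
  assumes M: "\<And>j. subspace (M j)" and W: "\<And>k. subspace (W k)" and N: "linear N"
    and maps: "\<And>x. x \<in> M (k + int l) \<inter> W k \<Longrightarrow> (N ^^ l) x \<in> M (k - int l) \<inter> W k"
    and kernel: "\<And>x. x \<in> M (k + int l) \<inter> W k \<Longrightarrow>
      x \<in> (M (k + int l - 1) \<inter> W k) + W (k - 1) \<longleftrightarrow>
      (N ^^ l) x \<in> (M (k - int l - 1) \<inter> W k) + W (k - 1)"
    and onto: "\<And>y. y \<in> M (k - int l) \<inter> W k \<Longrightarrow> \<exists>x \<in> M (k + int l) \<inter> W k.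
      (N ^^ l) x - y \<in> (M (k - int l - 1) \<inter> W k) + W (k - 1)"
  shows "\<exists>\<phi>. bij_betw \<phi> (gr_inc (induced M W k) (k + int l)) (gr_inc (induced M W k) (k - int l)) \<and>
      (\<forall>x \<in> M (k + int l) \<inter> W k.
         \<phi> (gr_class M W k (k + int l) x) = gr_class M W k (k - int l) ((N ^^ l) x))"
  unfolding gr_inc_induced
proof (rule bij_betw_classes)
  have lin: "linear (N ^^ l)"
  proof (induction l)
    case (Suc l)
    then have "linear (N \<circ> N ^^ l)"
      using N by (rule linear_compose)
    then show ?case
      by (simp only: funpow.simps)
  qed (simp add: linear_ident)
  fix x y assume xy: "x \<in> M (k + int l) \<inter> W k" "y \<in> M (k + int l) \<inter> W k"
  then have "x - y \<in> M (k + int l) \<inter> W k"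
    using subspace_diff M W by blast
  from kernel[OF this]
  show "gr_class M W k (k + int l) x = gr_class M W k (k + int l) y \<longleftrightarrow>
    gr_class M W k (k - int l) ((N ^^ l) x) = gr_class M W k (k - int l) ((N ^^ l) y)"
    by (simp add: gr_class_eq_iff[OF M W] linear_diff[OF lin])
qed (use maps onto in \<open>auto simp: gr_class_eq_iff[OF M W]\<close>)

lemma sum_subspace_left: "subspace B \<Longrightarrow> x \<in> A \<Longrightarrow> x \<in> A + B"
  for A B :: "'v::real_vector set"
  using set_plus_intro[of x A 0 B] subspace_0[of B] by simp

lemma sum_subspace_right: "subspace A \<Longrightarrow> x \<in> B \<Longrightarrow> x \<in> A + B"
  for A B :: "'v::real_vector set"
  using set_plus_intro[of 0 A x B] subspace_0[of A] by simp

text \<open>When source and target both vanish, the induced map is bijective for lack of choice; that \<open>N\<^sup>l\<close>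
  respects the filtrations is all that has to be known.\<close>

lemma gr_isomorphism_trivialI:
  fixes M W :: "int \<Rightarrow> 'v::real_vector set"
  assumes M: "\<And>j. subspace (M j)" and W: "\<And>k. subspace (W k)" and N: "linear N"
    and maps: "\<And>x. x \<in> M (k + int l) \<inter> W k \<Longrightarrow> (N ^^ l) x \<in> M (k - int l) \<inter> W k"
    and source: "M (k + int l) \<inter> W k \<subseteq> M (k + int l - 1) \<or> W k \<subseteq> W (k - 1)"
    and target: "M (k - int l) \<inter> W k \<subseteq> M (k - int l - 1) \<or> M (k - int l) \<inter> W k \<subseteq> W (k - 1)"
  shows "\<exists>\<phi>. bij_betw \<phi> (gr_inc (induced M W k) (k + int l)) (gr_inc (induced M W k) (k - int l)) \<and>
      (\<forall>x \<in> M (k + int l) \<inter> W k.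
         \<phi> (gr_class M W k (k + int l) x) = gr_class M W k (k - int l) ((N ^^ l) x))"
proof (rule gr_isomorphismI)
  show "subspace (M j)" "subspace (W j)" "linear N" for j
    by (rule M W N)+
  show "(N ^^ l) x \<in> M (k - int l) \<inter> W k" if "x \<in> M (k + int l) \<inter> W k" for x
    using that by (rule maps)
  have MW: "subspace (M j \<inter> W k)" for j
    by (intro subspace_inter M W)
  have zero_source: "x \<in> (M (k + int l - 1) \<inter> W k) + W (k - 1)"
    if "x \<in> M (k + int l) \<inter> W k" for x
    using that source sum_subspace_left[OF W] sum_subspace_right[OF MW] by blast
  have zero_target: "x \<in> (M (k - int l - 1) \<inter> W k) + W (k - 1)"
    if "x \<in> M (k - int l) \<inter> W k" for x
    using that target sum_subspace_left[OF W] sum_subspace_right[OF MW] by blast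
  show "x \<in> (M (k + int l - 1) \<inter> W k) + W (k - 1) \<longleftrightarrow>
      (N ^^ l) x \<in> (M (k - int l - 1) \<inter> W k) + W (k - 1)"
    if "x \<in> M (k + int l) \<inter> W k" for x
    using that zero_source zero_target maps by blast
  show "\<exists>x \<in> M (k + int l) \<inter> W k. (N ^^ l) x - y \<in> (M (k - int l - 1) \<inter> W k) + W (k - 1)"
    if y: "y \<in> M (k - int l) \<inter> W k" for y
  proof
    show z: "0 \<in> M (k + int l) \<inter> W k"
      by (rule subspace_0[OF MW])
    show "(N ^^ l) 0 - y \<in> (M (k - int l - 1) \<inter> W k) + W (k - 1)"
      by (rule zero_target[OF subspace_diff[OF MW maps[OF z] y]])
  qed
qed

text \<open>For \<open>l = 0\<close> the induced map is the identity.\<close>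

lemma gr_isomorphism_zero:
  fixes M W :: "int \<Rightarrow> 'v::real_vector set"
  shows "\<exists>\<phi>. bij_betw \<phi> (gr_inc (induced M W k) (k + int 0)) (gr_inc (induced M W k) (k - int 0)) \<and>
      (\<forall>x \<in> M (k + int 0) \<inter> W k.
         \<phi> (gr_class M W k (k + int 0) x) = gr_class M W k (k - int 0) ((N ^^ 0) x))"
  by (intro exI[of _ id]) simp

text \<open>If \<open>N\<close> lowers \<open>W\<close> by two, then \<open>N\<close> is zero on each \<open>Gr\<^sup>W\<^sub>k\<close>, whose weight filtration is therefore
  concentrated in weight \<open>k\<close>; this is what \<open>W\<close> itself induces.\<close>

lemma relative_weight_filtration_self:
  fixes W :: "int \<Rightarrow> 'v::real_vector set"
  assumes N: "linear N" "\<exists>n. \<forall>x\<in>U. (N ^^ n) x = 0"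
    and W: "increasing_filtration U W" and lower: "\<And>k. N ` W k \<subseteq> W (k - 2)"
  shows "is_relative_weight_filtration U N W W"
proof -
  have sub: "subspace (W k)" and mono: "mono W" for k
    using W by (auto simp: increasing_filtration_def)
  obtain b where b: "\<And>k. k \<ge> b \<Longrightarrow> W k = U"
    using W by (auto simp: increasing_filtration_def)
  have keep: "N ` W k \<subseteq> W k" for k
    using lower[of k] monoD[OF mono, of "k - 2" k] by auto
  have "\<exists>\<phi>. bij_betw \<phi> (gr_inc (induced W W k) (k + int l)) (gr_inc (induced W W k) (k - int l)) \<and>
      (\<forall>x \<in> W (k + int l) \<inter> W k.
         \<phi> (gr_class W W k (k + int l) x) = gr_class W W k (k - int l) ((N ^^ l) x))" for k l
  proof (cases "l = 0")
    case True
    show ?thesis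
      unfolding True by (rule gr_isomorphism_zero)
  next
    case False
    have power: "(N ^^ i) x \<in> W (k - 2 * int i)" if "x \<in> W k" for x i
    proof (induction i)
      case (Suc i)
      then have "N ((N ^^ i) x) \<in> W (k - 2 * int i - 2)"
        using lower by blast
      then show ?case
        by (simp add: algebra_simps)
    qed (use that in simp)
    show ?thesis
    proof (rule gr_isomorphism_trivialI[OF sub sub N(1)])
      fix x assume "x \<in> W (k + int l) \<inter> W k"
      then have "(N ^^ l) x \<in> W (k - 2 * int l)"
        using power by blast
      then show "(N ^^ l) x \<in> W (k - int l) \<inter> W k"
        using monoD[OF mono, of "k - 2 * int l" "k - int l"] monoD[OF mono, of "k - 2 * int l" k]
        by auto
    next
      show "W (k + int l) \<inter> W k \<subseteq> W (k + int l - 1) \<or> W k \<subseteq> W (k - 1)"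
        using False monoD[OF mono, of k "k + int l - 1"] by auto
      show "W (k - int l) \<inter> W k \<subseteq> W (k - int l - 1) \<or> W (k - int l) \<inter> W k \<subseteq> W (k - 1)"
        using False monoD[OF mono, of "k - int l" "k - 1"] by auto
    qed
  qed
  then show ?thesis
    unfolding is_relative_weight_filtration_def
    using N W lower keep keep[of b] b[of b] by auto
qed

text \<open>The monodromy weight filtration, centred at \<open>w\<close>, of an endomorphism with image and kernel \<open>L\<close>.\<close>

definition square_zero_weight :: "int \<Rightarrow> 'v::real_vector set \<Rightarrow> int \<Rightarrow> 'v set" where
  "square_zero_weight w L k = (if k < w - 1 then {0} else if k \<le> w then L else UNIV)"

lemma increasing_filtration_square_zero_weight:
  assumes "subspace L"
  shows "increasing_filtration UNIV (square_zero_weight w L)"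
  unfolding increasing_filtration_def
proof (intro conjI allI)
  show "subspace (square_zero_weight w L k)" for k
    using assms by (simp add: square_zero_weight_def)
  show "mono (square_zero_weight w L)"
    using subspace_0[OF assms] by (auto simp: square_zero_weight_def mono_def)
  show "\<exists>a. \<forall>k\<le>a. square_zero_weight w L k = {0}"
    by (intro exI[of _ "w - 2"]) (auto simp: square_zero_weight_def)
  show "\<exists>b. \<forall>k\<ge>b. square_zero_weight w L k = UNIV"
    by (intro exI[of _ "w + 1"]) (auto simp: square_zero_weight_def)
qed

lemma square_zero_weight_lower:
  assumes "linear N" "range N \<subseteq> L" "\<And>x. x \<in> L \<Longrightarrow> N x = 0"
  shows "N ` square_zero_weight w L k \<subseteq> square_zero_weight w L (k - 2)"
  using assms linear_0[OF assms(1)] by (auto simp: square_zero_weight_def)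

text \<open>The only isomorphism to check is \<open>N : V/L \<rightarrow> L\<close>, between the weights \<open>w + 1\<close> and \<open>w - 1\<close>; it is
  the first isomorphism theorem for \<open>N\<close>.\<close>

lemma relative_weight_filtration_pure:
  fixes W :: "int \<Rightarrow> 'v::real_vector set"
  assumes N: "linear N" and kernel: "\<And>x. N x = 0 \<longleftrightarrow> x \<in> L" and range: "range N = L"
    and W: "W = (\<lambda>k. if k < w then {0} else UNIV)"
  shows "is_relative_weight_filtration UNIV N W (square_zero_weight w L)"
proof -
  let ?M = "square_zero_weight w L"
  have L: "subspace L"
    using linear_subspace_image[OF N subspace_UNIV] range by simp
  have M: "increasing_filtration UNIV ?M"
    using L by (rule increasing_filtration_square_zero_weight)
  then have subM: "subspace (?M k)" and monoM: "mono ?M" for k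
    by (auto simp: increasing_filtration_def)
  have subW: "subspace (W k)" for k
    by (simp add: W)
  have WF: "increasing_filtration UNIV W"
    unfolding increasing_filtration_def
  proof (intro conjI allI subW)
    show "mono W"
      by (auto simp: W mono_def)
    show "\<exists>a. \<forall>k\<le>a. W k = {0}"
      by (intro exI[of _ "w - 1"]) (auto simp: W)
    show "\<exists>b. \<forall>k\<ge>b. W k = UNIV"
      by (intro exI[of _ w]) (auto simp: W)
  qed
  have keep: "N ` W k \<subseteq> W k" for k
    using linear_0[OF N] by (auto simp: W)
  have lower: "N ` ?M k \<subseteq> ?M (k - 2)" for k
    using N range kernel by (intro square_zero_weight_lower) auto
  have square: "N (N x) = 0" for x
    using kernel range by auto
  have power: "(N ^^ l) x = 0" if "l \<ge> 2" for l x
  proof -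
    obtain m where l: "l = m + 2"
      using \<open>l \<ge> 2\<close> by (metis add.commute le_iff_add)
    show ?thesis
      unfolding l funpow_add by (induction m) (auto simp: numeral_2_eq_2 square linear_0[OF N])
  qed
  have "\<exists>\<phi>. bij_betw \<phi> (gr_inc (induced ?M W k) (k + int l)) (gr_inc (induced ?M W k) (k - int l)) \<and>
      (\<forall>x \<in> ?M (k + int l) \<inter> W k.
         \<phi> (gr_class ?M W k (k + int l) x) = gr_class ?M W k (k - int l) ((N ^^ l) x))" for k l
  proof -
    (* For k \<noteq> w the graded piece of W is zero; for k = w and l \<ge> 2 the weights w + l and w - l lie
       outside the range of M. This leaves l = 1. *)
    consider "l = 0" | "l > 0" "k < w" | "k > w" | "l \<ge> 2" "k = w" | "l = 1" "k = w"
      by linarith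
    then show ?thesis
    proof cases
      case 1
      show ?thesis
        unfolding 1 by (rule gr_isomorphism_zero)
    next
      case 2
      have zero: "(N ^^ l) 0 = 0"
        by (induction l) (auto simp: linear_0[OF N])
      show ?thesis
        using 2 zero subspace_0[OF subM]
        by (intro gr_isomorphism_trivialI[OF subM subW N]) (auto simp: W)
    next
      case 3
      have power': "(N ^^ i) x \<in> ?M (j - 2 * int i)" if "x \<in> ?M j" for x i j
      proof (induction i)
        case (Suc i)
        then have "N ((N ^^ i) x) \<in> ?M (j - 2 * int i - 2)"
          using lower by blast
        then show ?case
          by (simp add: algebra_simps)
      qed (use that in simp)
      show ?thesis
      proof (rule gr_isomorphism_trivialI[OF subM subW N])
        fix x assume "x \<in> ?M (k + int l) \<inter> W k"
        then have "(N ^^ l) x \<in> ?M (k + int l - 2 * int l)"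
          using power' by blast
        then show "(N ^^ l) x \<in> ?M (k - int l) \<inter> W k"
          using 3 by (simp add: W)
      qed (use 3 in \<open>auto simp: W\<close>)
    next
      case 4
      show ?thesis
        using 4 power subspace_0[OF subM]
        by (intro gr_isomorphism_trivialI[OF subM subW N]) (auto simp: W square_zero_weight_def)
    next
      case 5
      have plus: "x \<in> A + {0} \<longleftrightarrow> x \<in> A" for x and A :: "'v set"
        by (auto simp: set_plus_def)
      show ?thesis
        unfolding 5 using kernel range
        by (intro gr_isomorphismI[OF subM subW N])
          (auto simp: W square_zero_weight_def plus image_iff dest: sym)
    qed
  qed
  moreover have "\<exists>n. \<forall>x\<in>UNIV. (N ^^ n) x = 0"
    using power[of 2] by blast
  ultimately show ?thesis
    unfolding is_relative_weight_filtration_def using N WF keep M lower by auto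
qed

section \<open>Mixed Hodge structures of Hodge--Tate type\<close>

text \<open>Opposedness on a quotient \<open>B/A\<close>, read off representatives. As \<open>A\<close> is stable under conjugation, a
  class common to the two opposed steps has representatives \<open>a\<close> and \<open>cconj b\<close> that differ by an element of
  \<open>A\<close>; it is zero exactly if \<open>a\<close> lies in \<open>A\<close>.\<close>

lemma pure_hodge_quotientI:
  fixes A B :: "'v::real_vector set"
  assumes A: "subspace A" and B: "subspace B" and AB: "A \<subseteq> B" and F: "\<And>p. 0 \<in> F p"
    and split: "\<And>p z. z \<in> complexify B \<Longrightarrow> \<exists>a \<in> F p \<inter> complexify B.
      \<exists>b \<in> F (n + 1 - p) \<inter> complexify B. z - (a + cconj b) \<in> complexify A"
    and meet: "\<And>p a b. a \<in> F p \<inter> complexify B \<Longrightarrow> b \<in> F (n + 1 - p) \<inter> complexify B \<Longrightarrow>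
      a - cconj b \<in> complexify A \<Longrightarrow> a \<in> complexify A"
  shows "pure_hodge n (cosets (complexify A) (complexify B)) (complexify A) (image cconj)
    (\<lambda>p. cosets (complexify A) (F p \<inter> complexify B))"
  unfolding pure_hodge_def
proof (intro allI conjI)
  fix p
  let ?A = "complexify A" and ?B = "complexify B"
  let ?F = "\<lambda>p. cosets ?A (F p \<inter> ?B)"
  note CA = subspace_complexify[OF A] and CB = subspace_complexify[OF B]
  have conj: "image cconj ` ?F q = (\<lambda>b. cconj b +o ?A) ` (F q \<inter> ?B)" for q
    by (simp add: cosets_def image_image cconj_coset[OF A])
  show "?F p + image cconj ` ?F (n + 1 - p) = cosets ?A ?B"
  proof
    show "?F p + image cconj ` ?F (n + 1 - p) \<subseteq> cosets ?A ?B"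
    proof
      fix X assume "X \<in> ?F p + image cconj ` ?F (n + 1 - p)"
      then obtain a b where "a \<in> ?B" "b \<in> ?B" "X = (a +o ?A) + (cconj b +o ?A)"
        unfolding conj by (auto simp: cosets_def elim!: set_plus_elim)
      moreover from this have "a + cconj b \<in> ?B"
        using subspace_add[OF CB] cconj_complexify[OF B] by blast
      ultimately show "X \<in> cosets ?A ?B"
        by (auto simp: coset_add[OF CA] cosets_def)
    qed
    show "cosets ?A ?B \<subseteq> ?F p + image cconj ` ?F (n + 1 - p)"
    proof
      fix X assume "X \<in> cosets ?A ?B"
      then obtain z where z: "z \<in> ?B" "X = z +o ?A"
        by (auto simp: cosets_def)
      obtain a b where ab: "a \<in> F p \<inter> ?B" "b \<in> F (n + 1 - p) \<inter> ?B" "z - (a + cconj b) \<in> ?A"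
        using split[OF z(1)] by blast
      then have "X = (a +o ?A) + (cconj b +o ?A)"
        unfolding z(2) coset_add[OF CA] by (simp only: coset_eq_iff[OF CA])
      then show "X \<in> ?F p + image cconj ` ?F (n + 1 - p)"
        unfolding conj using ab by (auto simp: cosets_def)
    qed
  qed
  show "?F p \<inter> image cconj ` ?F (n + 1 - p) = {?A}"
  proof
    show "?F p \<inter> image cconj ` ?F (n + 1 - p) \<subseteq> {?A}"
    proof
      fix X assume "X \<in> ?F p \<inter> image cconj ` ?F (n + 1 - p)"
      then obtain a b where a: "a \<in> F p \<inter> ?B" "X = a +o ?A"
        and b: "b \<in> F (n + 1 - p) \<inter> ?B" "X = cconj b +o ?A"
        unfolding conj by (auto simp: cosets_def)
      then have "a - cconj b \<in> ?A"
        using coset_eq_iff[OF CA] by blast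
      then have "a - 0 \<in> ?A"
        using meet[OF a(1) b(1)] by simp
      then have "X = 0 +o ?A"
        unfolding a(2) by (simp only: coset_eq_iff[OF CA])
      then show "X \<in> {?A}"
        by (simp add: coset_zero)
    qed
    have zero: "0 \<in> F q \<inter> ?B" for q
      using F subspace_0[OF CB] by blast
    then have "0 +o ?A \<in> ?F p" "cconj 0 +o ?A \<in> image cconj ` ?F (n + 1 - p)"
      unfolding conj unfolding cosets_def by (rule imageI)+
    then show "{?A} \<subseteq> ?F p \<inter> image cconj ` ?F (n + 1 - p)"
      by (simp add: coset_zero)
  qed
qed

text \<open>The graded piece of weight \<open>2q\<close> is of type \<open>(q,q)\<close>: \<open>F\<^sup>q\<close> induces all of it and \<open>F\<^sup>q\<^sup>+\<^sup>1\<close> induces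
  zero. Those of odd weight vanish.\<close>

definition hodge_tate ::
  "'v::real_vector set \<Rightarrow> (int \<Rightarrow> ('v \<times> 'v) set) \<Rightarrow> (int \<Rightarrow> 'v set) \<Rightarrow> bool" where
  "hodge_tate U F W \<longleftrightarrow>
     increasing_filtration U W \<and> decreasing_filtration (complexify U) F \<and>
     (\<forall>q. W (2 * q + 1) = W (2 * q) \<and>
       complexify (W (2 * q)) \<subseteq> F q + complexify (W (2 * q - 1)) \<and>
       F (q + 1) \<inter> complexify (W (2 * q)) \<subseteq> complexify (W (2 * q - 1)))"

text \<open>In weight \<open>2q\<close>, one of \<open>p\<close> and \<open>2q + 1 - p\<close> is at most \<open>q\<close> and the other exceeds \<open>q\<close>. So of the two
  opposed filtration steps one is everything and the other is zero.\<close>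

lemma hodge_tate_imp_mixed_hodge:
  fixes W :: "int \<Rightarrow> 'v::real_vector set"
  assumes "hodge_tate U F W"
  shows "mixed_hodge_structure U F W"
proof -
  have W: "increasing_filtration U W" and F: "decreasing_filtration (complexify U) F"
    and odd: "\<And>q. W (2 * q + 1) = W (2 * q)"
    and full: "\<And>q. complexify (W (2 * q)) \<subseteq> F q + complexify (W (2 * q - 1))"
    and none: "\<And>q. F (q + 1) \<inter> complexify (W (2 * q)) \<subseteq> complexify (W (2 * q - 1))"
    using assms by (auto simp: hodge_tate_def)
  have sub: "subspace (W k)" and mono: "mono W" for k
    using W by (auto simp: increasing_filtration_def)
  have csub: "cx.subspace (F p)" and anti: "antimono F" for p
    using F by (auto simp: decreasing_filtration_def)
  have F0: "0 \<in> F p" for p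
    using cx.subspace_0[OF csub] .
  have step: "W (k - 1) \<subseteq> W k" for k
    by (rule monoD[OF mono]) simp
  have pure: "pure_hodge k (cosets (complexify (W (k - 1))) (complexify (W k)))
      (complexify (W (k - 1))) (image cconj)
      (\<lambda>p. cosets (complexify (W (k - 1))) (F p \<inter> complexify (W k)))" for k
  proof (rule pure_hodge_quotientI[OF sub sub step F0])
    let ?A = "complexify (W (k - 1))" and ?B = "complexify (W k)"
    note CA = subspace_complexify[OF sub[of "k - 1"]]
    have AB: "?A \<subseteq> ?B"
      by (rule complexify_mono[OF step])
    have B0: "0 \<in> ?B"
      by (rule subspace_0[OF subspace_complexify[OF sub]])
    fix p
    show "\<exists>a \<in> F p \<inter> ?B. \<exists>b \<in> F (k + 1 - p) \<inter> ?B. z - (a + cconj b) \<in> ?A" if z: "z \<in> ?B" for z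
    proof (cases "even k")
      case False
      then obtain q where "k = 2 * q + 1"
        by (auto elim: oddE)
      then have "z \<in> ?A"
        using z odd[of q] by simp
      then have "z - (0 + cconj 0) \<in> ?A"
        by simp
      then show ?thesis
        using F0 B0 by blast
    next
      case True
      then obtain q where k: "k = 2 * q"
        by (auto elim: evenE)
      have fill: "\<exists>a \<in> F m \<inter> ?B. u - a \<in> ?A" if m: "m \<le> q" and u: "u \<in> ?B" for u m
      proof -
        obtain a w where a: "a \<in> F q" "w \<in> ?A" "u = a + w"
          using u full[of q] unfolding k by (blast elim: set_plus_elim)
        have "a \<in> F m"
          using a(1) antimonoD[OF anti m] by blast
        moreover have "u - w \<in> ?B"
          using u a(2) AB by (intro subspace_diff subspace_complexify sub) auto
        then have "a \<in> ?B"
          by (simp add: a(3))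
        ultimately show ?thesis
          using a by (intro bexI[of _ a]) auto
      qed
      show ?thesis
      proof (cases "p \<le> q")
        case True
        then obtain a where "a \<in> F p \<inter> ?B" "z - a \<in> ?A"
          using fill[OF _ z] by blast
        moreover from this have "z - (a + cconj 0) \<in> ?A"
          by simp
        ultimately show ?thesis
          using F0 B0 by blast
      next
        case False
        then have "k + 1 - p \<le> q"
          using k by simp
        then obtain b where b: "b \<in> F (k + 1 - p) \<inter> ?B" "cconj z - b \<in> ?A"
          using fill cconj_complexify[OF sub z] by blast
        have "cconj (cconj z - b) = z - (0 + cconj b)"
          by (simp add: cconj_def prod_eq_iff)
        then have "z - (0 + cconj b) \<in> ?A"
          using cconj_complexify[OF sub b(2)] by simp
        then show ?thesis
          using F0 B0 b(1) by blast
      qed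
    qed
    show "a \<in> ?A" if a: "a \<in> F p \<inter> ?B" and b: "b \<in> F (k + 1 - p) \<inter> ?B" and d: "a - cconj b \<in> ?A"
      for a b
    proof (cases "even k")
      case False
      then obtain q where "k = 2 * q + 1"
        by (auto elim: oddE)
      then show ?thesis
        using a odd[of q] by simp
    next
      case True
      then obtain q where k: "k = 2 * q"
        by (auto elim: evenE)
      have vanish: "u \<in> ?A" if "m > q" "u \<in> F m \<inter> ?B" for u m
        using that none[of q] antimonoD[OF anti, of "q + 1" m] unfolding k by auto
      show ?thesis
      proof (cases "p \<le> q")
        case True
        then have "b \<in> ?A"
          using vanish[of "k + 1 - p" b] b k by simp
        then have "(a - cconj b) + cconj b \<in> ?A"
          using d cconj_complexify[OF sub] by (intro subspace_add[OF CA]) auto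
        then show ?thesis
          by simp
      next
        case False
        then show ?thesis
          using vanish[OF _ a] by simp
      qed
    qed
  qed
  have "induced F (\<lambda>k. complexify (W k)) k =
      (\<lambda>p. cosets (complexify (W (k - 1))) (F p \<inter> complexify (W k)))" for k
    by (simp add: induced_def fun_eq_iff)
  then show ?thesis
    unfolding mixed_hodge_structure_def gr_inc_def Let_def using W F pure by simp
qed

lemma increasing_filtration_restrict:
  assumes W: "increasing_filtration V W" and U: "subspace U" "U \<subseteq> V"
  shows "increasing_filtration U (restrict_fil W U)"
proof -
  obtain a b where "\<And>k. k \<le> a \<Longrightarrow> W k = {0}" "\<And>k. k \<ge> b \<Longrightarrow> W k = V"
    using W by (auto simp: increasing_filtration_def)
  then have "\<forall>k\<le>a. restrict_fil W U k = {0}" "\<forall>k\<ge>b. restrict_fil W U k = U"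
    using U subspace_0[OF U(1)] by (auto simp: restrict_fil_def)
  moreover have "subspace (restrict_fil W U k)" for k
    using W U by (simp add: restrict_fil_def increasing_filtration_def subspace_inter)
  moreover have "mono (restrict_fil W U)"
    using W by (auto simp: restrict_fil_def increasing_filtration_def mono_def)
  ultimately show ?thesis
    unfolding increasing_filtration_def by blast
qed

lemma decreasing_filtration_restrict:
  assumes F: "decreasing_filtration H F" and K: "cx.subspace K" "K \<subseteq> H"
  shows "decreasing_filtration K (restrict_fil F K)"
proof -
  obtain a b where "\<And>p. p \<le> a \<Longrightarrow> F p = H" "\<And>p. p \<ge> b \<Longrightarrow> F p = {0}"
    using F by (auto simp: decreasing_filtration_def)
  then have "\<forall>p\<le>a. restrict_fil F K p = K" "\<forall>p\<ge>b. restrict_fil F K p = {0}"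
    using K cx.subspace_0[OF K(1)] by (auto simp: restrict_fil_def)
  moreover have "cx.subspace (restrict_fil F K p)" for p
    using F K by (simp add: restrict_fil_def decreasing_filtration_def cx.subspace_inter)
  moreover have "antimono (restrict_fil F K)"
    using F by (auto simp: restrict_fil_def decreasing_filtration_def antimono_def)
  ultimately show ?thesis
    unfolding decreasing_filtration_def by blast
qed

text \<open>Restriction to \<open>W l\<close> leaves the graded pieces of weight at most \<open>l\<close> unchanged, with the same induced
  Hodge filtration, and kills the others.\<close>

lemma hodge_tate_restrict:
  fixes W :: "int \<Rightarrow> 'v::real_vector set"
  assumes HT: "hodge_tate V F W"
  shows "hodge_tate (W l) (restrict_fil F (complexify (W l))) (restrict_fil W (W l))"
proof -
  let ?U = "W l"
  have W: "increasing_filtration V W" and F: "decreasing_filtration (complexify V) F"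
    and odd: "\<And>q. W (2 * q + 1) = W (2 * q)"
    and full: "\<And>q. complexify (W (2 * q)) \<subseteq> F q + complexify (W (2 * q - 1))"
    and none: "\<And>q. F (q + 1) \<inter> complexify (W (2 * q)) \<subseteq> complexify (W (2 * q - 1))"
    using HT by (auto simp: hodge_tate_def)
  have sub: "subspace (W k)" and mono: "mono W" for k
    using W by (auto simp: increasing_filtration_def)
  obtain b where "\<And>k. k \<ge> b \<Longrightarrow> W k = V"
    using W by (auto simp: increasing_filtration_def)
  then have UV: "?U \<subseteq> V"
    using monoD[OF mono, of l "max l b"] by simp
  have low: "restrict_fil W ?U k = W k" if "k \<le> l" for k
    using monoD[OF mono that] by (auto simp: restrict_fil_def)
  have high: "restrict_fil W ?U k = ?U" if "l \<le> k" for k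
    using monoD[OF mono that] by (auto simp: restrict_fil_def)
  have cU: "cx.subspace (complexify ?U)"
    by (rule cx_subspace_complexify[OF sub])
  have "complexify (restrict_fil W ?U (2 * q)) \<subseteq>
        restrict_fil F (complexify ?U) q + complexify (restrict_fil W ?U (2 * q - 1)) \<and>
      restrict_fil F (complexify ?U) (q + 1) \<inter> complexify (restrict_fil W ?U (2 * q)) \<subseteq>
        complexify (restrict_fil W ?U (2 * q - 1))" for q
  proof (cases "2 * q \<le> l")
    case True
    have AB: "complexify (W (2 * q - 1)) \<subseteq> complexify (W (2 * q))"
      by (intro complexify_mono monoD[OF mono]) simp
    have BU: "complexify (W (2 * q)) \<subseteq> complexify ?U"
      by (rule complexify_mono[OF monoD[OF mono True]])
    have "z \<in> (F q \<inter> complexify ?U) + complexify (W (2 * q - 1))"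
      if z: "z \<in> complexify (W (2 * q))" for z
    proof -
      obtain a w where aw: "a \<in> F q" "w \<in> complexify (W (2 * q - 1))" "z = a + w"
        using z full[of q] by (blast elim: set_plus_elim)
      have "z - w \<in> complexify ?U"
        using z aw(2) AB BU by (intro subspace_diff subspace_complexify sub) auto
      then show ?thesis
        using aw by (auto intro!: set_plus_intro)
    qed
    then show ?thesis
      using True low none[of q] by (auto simp: restrict_fil_def[of F])
  next
    case False
    have "0 \<in> restrict_fil F (complexify ?U) q"
      using F cx.subspace_0 cx.subspace_0[OF cU]
      by (auto simp: restrict_fil_def decreasing_filtration_def)
    then have "z \<in> restrict_fil F (complexify ?U) q + complexify ?U" if "z \<in> complexify ?U" for z
      using set_plus_intro[OF _ that, of 0] by simp
    then show ?thesis
      using False high by auto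
  qed
  moreover have "restrict_fil W ?U (2 * q + 1) = restrict_fil W ?U (2 * q)" for q
    by (simp add: restrict_fil_def odd)
  ultimately show ?thesis
    unfolding hodge_tate_def
    using increasing_filtration_restrict[OF W sub UV]
      decreasing_filtration_restrict[OF F cU complexify_mono[OF UV]] by blast
qed

section \<open>The example\<close>

text \<open>A filtration does not move across an interval of indices in which it has no jumps; with finiteness this
  determines its outer steps.\<close>

lemma filtration_const:
  fixes G :: "int \<Rightarrow> 'a set"
  assumes "\<And>k. a \<le> k \<Longrightarrow> k < b \<Longrightarrow> G k = G (k + 1)" "a \<le> b"
  shows "G a = G b"
  using assms(2,1)
proof (induction b rule: int_ge_induct)
  case (step i)
  have "G a = G i"
    by (rule step.IH, rule step.prems) auto
  also have "G i = G (i + 1)"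
    by (rule step.prems) (use step.hyps in auto)
  finally show ?case .
qed simp

lemma pure_increasing_filtration:
  assumes W: "increasing_filtration U W" and gr: "\<And>k. k \<noteq> w \<Longrightarrow> gr_inc W k = {W (k - 1)}"
  shows "W = (\<lambda>k. if k < w then {0} else U)"
proof
  fix k
  have sub: "subspace (W k)" and mono: "mono W" for k
    using W by (auto simp: increasing_filtration_def)
  have eq: "W k = W (k + 1)" if "k + 1 \<noteq> w" for k
  proof
    show "W k \<subseteq> W (k + 1)"
      by (rule monoD[OF mono]) simp
    show "W (k + 1) \<subseteq> W k"
      using gr[OF that] subspace_0[OF sub] cosets_trivial_imp_subset[of "W k" "W (k + 1)"]
      by (simp add: gr_inc_def)
  qed
  obtain a b where a: "\<And>k. k \<le> a \<Longrightarrow> W k = {0}" and b: "\<And>k. k \<ge> b \<Longrightarrow> W k = U"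
    using W by (auto simp: increasing_filtration_def)
  show "W k = (if k < w then {0} else U)"
  proof (cases "k < w")
    case True
    have "W (min a k) = W k"
      by (rule filtration_const[of "min a k" k W], rule eq) (use True in auto)
    then show ?thesis
      using True a by simp
  next
    case False
    have "W k = W (max b k)"
      by (rule filtration_const[of k "max b k" W], rule eq) (use False in auto)
    then show ?thesis
      using False b by simp
  qed
qed

lemma decreasing_filtration_bounds:
  assumes F: "decreasing_filtration H F" and gr: "\<And>k. k \<notin> {m..n} \<Longrightarrow> gr_dec F k = {F (k + 1)}"
  shows "p \<le> m \<Longrightarrow> F p = H" and "n < p \<Longrightarrow> F p = {0}"
proof -
  have sub: "cx.subspace (F p)" and anti: "antimono F" for p
    using F by (auto simp: decreasing_filtration_def)
  have eq: "F k = F (k + 1)" if "k \<notin> {m..n}" for k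
  proof
    show "F (k + 1) \<subseteq> F k"
      by (rule antimonoD[OF anti]) simp
    show "F k \<subseteq> F (k + 1)"
      using gr[OF that] cx.subspace_0[OF sub] cosets_trivial_imp_subset[of "F (k + 1)" "F k"]
      by (simp add: gr_dec_def)
  qed
  obtain a b where a: "\<And>k. k \<le> a \<Longrightarrow> F k = H" and b: "\<And>k. k \<ge> b \<Longrightarrow> F k = {0}"
    using F by (auto simp: decreasing_filtration_def)
  show "F p = H" if "p \<le> m"
  proof -
    have "F (min a p) = F p"
      by (rule filtration_const[of "min a p" p F], rule eq) (use that in auto)
    then show ?thesis
      using a by simp
  qed
  show "F p = {0}" if "n < p"
  proof -
    have "F p = F (max b p)"
      by (rule filtration_const[of p "max b p" F], rule eq) (use that in auto)
    then show ?thesis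
      using b by simp
  qed
qed

lemma in_span_pair_iff: "x \<in> span {a, b} \<longleftrightarrow> (\<exists>s t. x = s *\<^sub>R a + t *\<^sub>R b)"
  for x :: "'v::real_vector"
  by (auto simp: span_breakdown_eq algebra_simps)

lemma cx_span_real_pair: "cx.span {(a, 0), (b, 0)} = complexify (span {a, b})"
  for a b :: "'v::real_vector"
proof
  have "subspace (span {a, b})"
    by simp
  moreover have "{(a, 0), (b, 0)} \<subseteq> complexify (span {a, b})"
    by (auto simp: complexify_def span_base span_zero)
  ultimately show "cx.span {(a, 0), (b, 0)} \<subseteq> complexify (span {a, b})"
    by (intro cx.span_minimal cx_subspace_complexify)
  show "complexify (span {a, b}) \<subseteq> cx.span {(a, 0), (b, 0)}"
  proof
    fix z assume "z \<in> complexify (span {a, b})"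
    then obtain s t s' t' where "z = (s *\<^sub>R a + t *\<^sub>R b, s' *\<^sub>R a + t' *\<^sub>R b)"
      by (auto simp: complexify_def in_span_pair_iff)
    then have "z = cscale (Complex s s') (a, 0) + cscale (Complex t t') (b, 0)"
      by (simp add: cscale_def)
    then show "z \<in> cx.span {(a, 0), (b, 0)}"
      by (simp only:) (intro cx.span_add cx.span_scale cx.span_base; simp)
  qed
qed

theorem proposition6p36:
  fixes e1 f1 e2 f2 :: "'v::real_vector"
    and N1 N2 :: "'v \<Rightarrow> 'v"
    and W :: "int \<Rightarrow> 'v set"
    and F :: "int \<Rightarrow> ('v \<times> 'v) set"
  assumes "distinct [e1, f1, e2, f2]"
    and "independent {e1, f1, e2, f2}"
    and "span {e1, f1, e2, f2} = UNIV"
    and "linear N1" "N1 e1 = f1" "N1 f1 = 0" "N1 e2 = f2" "N1 f2 = 0"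
    and "linear N2" "N2 e1 = f2" "N2 f1 = 0" "N2 e2 = 0" "N2 f2 = 0"
    and "increasing_filtration UNIV W"
    and "\<And>k. k \<noteq> 1 \<Longrightarrow> gr_inc W k = {W (k - 1)}"
    and "decreasing_filtration UNIV F"
    and "\<And>k. k \<notin> {0..1} \<Longrightarrow> gr_dec F k = {F (k + 1)}"
    and "F 1 = cx.span {(e1, 0), (e2, 0)}"
  shows "deligne_hodge_system 2 W (\<lambda>j. if j = 1 then N1 else N2) F"
proof -
  define L where "L = span {f1, f2}"
  define M where "M = square_zero_weight 1 L"
  have L: "subspace L"
    by (simp add: L_def)
  have in_L: "x \<in> L \<longleftrightarrow> (\<exists>s t. x = s *\<^sub>R f1 + t *\<^sub>R f2)" for x
    by (simp add: L_def in_span_pair_iff)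
  have coords: "\<exists>e t u. e \<in> span {e1, e2} \<and> x = e + (t *\<^sub>R f1 + u *\<^sub>R f2)" for x
  proof -
    have "x \<in> span ({e1, e2} \<union> {f1, f2})"
      using assms(3) by (simp add: insert_commute)
    then show ?thesis
      unfolding span_Un by (auto simp: in_span_pair_iff[of _ f1 f2])
  qed
  have f_indep: "s = 0 \<and> t = 0" if "s *\<^sub>R f1 + t *\<^sub>R f2 = 0" for s t
  proof -
    have "independent {f1, f2}" "f1 \<noteq> f2"
      using assms(1) by (auto intro!: independent_mono[OF assms(2)])
    moreover from this have "(if v = f1 then s else t) = 0" if "v \<in> {f1, f2}" for v
      using \<open>s *\<^sub>R f1 + t *\<^sub>R f2 = 0\<close> that
      by (intro independentD[of "{f1, f2}" "{f1, f2}"]) auto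
    ultimately show ?thesis
      by (metis insertI1 insertI2)
  qed
  note N1_simps = linear_add[OF assms(4)] linear_scale[OF assms(4)] assms(5-8)
  note N2_simps = linear_add[OF assms(9)] linear_scale[OF assms(9)] assms(10-13)
  have N1_kernel: "N1 x = 0 \<longleftrightarrow> x \<in> L" for x
  proof
    obtain s t u v where x: "x = (s *\<^sub>R e1 + t *\<^sub>R e2) + (u *\<^sub>R f1 + v *\<^sub>R f2)"
      using coords[of x] by (auto simp: in_span_pair_iff)
    assume "N1 x = 0"
    then have "s = 0 \<and> t = 0"
      by (intro f_indep) (simp add: x N1_simps)
    then show "x \<in> L"
      using x in_L by auto
  qed (auto simp: in_L N1_simps)
  have N1_range: "range N1 = L"
  proof
    show "range N1 \<subseteq> L"
    proof (rule image_subsetI)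
      fix x
      obtain s t u v where "x = (s *\<^sub>R e1 + t *\<^sub>R e2) + (u *\<^sub>R f1 + v *\<^sub>R f2)"
        using coords[of x] by (auto simp: in_span_pair_iff)
      then show "N1 x \<in> L"
        unfolding in_L by (simp add: N1_simps) blast
    qed
    show "L \<subseteq> range N1"
    proof
      fix y assume "y \<in> L"
      then obtain s t where "y = N1 (s *\<^sub>R e1 + t *\<^sub>R e2)"
        by (auto simp: in_L N1_simps)
      then show "y \<in> range N1"
        by blast
    qed
  qed
  have N2_L: "N2 x = 0" if "x \<in> L" for x
    using that by (auto simp: in_L N2_simps)
  have N2_range: "range N2 \<subseteq> L"
  proof (rule image_subsetI)
    fix x
    obtain s t u v where "x = (s *\<^sub>R e1 + t *\<^sub>R e2) + (u *\<^sub>R f1 + v *\<^sub>R f2)"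
      using coords[of x] by (auto simp: in_span_pair_iff)
    then have "N2 x = 0 *\<^sub>R f1 + s *\<^sub>R f2"
      by (simp add: N2_simps)
    then show "N2 x \<in> L"
      unfolding in_L by blast
  qed
  let ?N = "\<lambda>j::nat. if j = 1 then N1 else N2"
  have lin: "linear (?N j)" and rangeL: "range (?N j) \<subseteq> L"
    and killL: "\<And>x. x \<in> L \<Longrightarrow> ?N j x = 0" for j
    using assms(4,9) N1_range N1_kernel N2_range N2_L by auto
  have NN: "?N i (?N j x) = 0" for i j x
    using rangeL[of j] killL[of "?N j x" i] by blast
  have nil: "\<exists>n. \<forall>x. (?N j ^^ n) x = 0" for j
  proof (intro exI allI)
    show "(?N j ^^ 2) x = 0" for x
      using NN[of j j x] by (simp add: numeral_2_eq_2)
  qed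

  have W: "W = (\<lambda>k. if k < 1 then {0} else UNIV)"
    using assms(14,15) by (rule pure_increasing_filtration)
  have F_low: "F p = UNIV" if "p \<le> 0" for p
    using assms(16,17) that by (rule decreasing_filtration_bounds)
  have F_high: "F p = {0}" if "1 < p" for p
    using assms(16,17) that by (rule decreasing_filtration_bounds)
  have F1: "F 1 = complexify (span {e1, e2})"
    unfolding assms(18) by (rule cx_span_real_pair)
  have M: "increasing_filtration UNIV M"
    unfolding M_def using L by (rule increasing_filtration_square_zero_weight)
  have lowerM: "?N j ` M k \<subseteq> M (k - 2)" for j k
    unfolding M_def by (rule square_zero_weight_lower[OF lin rangeL killL])
  have keepM: "?N j ` M k \<subseteq> M k" for j k
  proof -
    have "M (k - 2) \<subseteq> M k"
      using M by (intro monoD[of M]) (auto simp: increasing_filtration_def)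
    then show ?thesis
      using lowerM by blast
  qed
  have keepW: "?N j ` W k \<subseteq> W k" for j k
    using linear_0[OF lin[of j]] by (auto simp: W)

  have step1: "is_relative_weight_filtration UNIV N1 W M"
    unfolding M_def using assms(4) N1_kernel N1_range W by (rule relative_weight_filtration_pure)
  have step2: "is_relative_weight_filtration UNIV N2 M M"
    using lin[of 2] nil[of 2] M lowerM[of 2] by (intro relative_weight_filtration_self) auto
  have "{0} = M (- 1)" "UNIV = M 2"
    by (simp_all add: M_def square_zero_weight_def)
  then have W_step: "\<exists>l'. W l = M l'" for l
    by (auto simp: W)
  have step2_restrict: "is_relative_weight_filtration (M l) N2
      (restrict_fil M (M l)) (restrict_fil M (M l))" for l
  proof (rule relative_weight_filtration_self)
    show "linear N2" "\<exists>n. \<forall>x\<in>M l. (N2 ^^ n) x = 0"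
      using lin[of 2] nil[of 2] by auto
    show "increasing_filtration (M l) (restrict_fil M (M l))"
      using M by (intro increasing_filtration_restrict) (auto simp: increasing_filtration_def)
    show "N2 ` restrict_fil M (M l) k \<subseteq> restrict_fil M (M l) (k - 2)" for k
      using lowerM[of 2 k] keepM[of 2 l] by (auto simp: restrict_fil_def)
  qed

  have E_L: "complexify (span {e1, e2}) \<inter> complexify L \<subseteq> {0}"
  proof -
    have "x = 0" if e: "x \<in> span {e1, e2}" and l: "x \<in> L" for x
    proof -
      obtain s t where x: "x = s *\<^sub>R e1 + t *\<^sub>R e2"
        using e by (auto simp: in_span_pair_iff)
      have "N1 x = 0"
        using l N1_kernel by blast
      then have "s = 0 \<and> t = 0"
        by (intro f_indep) (simp add: x N1_simps)
      then show ?thesis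
        by (simp add: x)
    qed
    then show ?thesis
      by (auto simp: complexify_def zero_prod_def)
  qed
  have E_plus_L: "z \<in> complexify (span {e1, e2}) + complexify L" for z
  proof -
    obtain e e' l l' where "e \<in> span {e1, e2}" "e' \<in> span {e1, e2}" "l \<in> L" "l' \<in> L"
      "fst z = e + l" "snd z = e' + l'"
      using coords[of "fst z"] coords[of "snd z"] in_L by metis
    then have "z = (e, e') + (l, l')" "(e, e') \<in> complexify (span {e1, e2})"
      "(l, l') \<in> complexify L"
      by (auto simp: complexify_def prod_eq_iff)
    then show ?thesis
      by (simp only: set_plus_intro)
  qed
  have HT: "hodge_tate UNIV F M"
    unfolding hodge_tate_def
  proof (intro conjI allI M)
    show "decreasing_filtration (complexify UNIV) F"
      using assms(16) by (simp add: complexify_def)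
    fix q :: int
    show "M (2 * q + 1) = M (2 * q)"
      by (simp add: M_def square_zero_weight_def)
    have F0: "0 \<in> F q"
      using assms(16) cx.subspace_0 by (auto simp: decreasing_filtration_def)
    have plus_F: "z \<in> F q + A" if "z \<in> A" for z A
      using set_plus_intro[OF F0 that] by simp
    have complexify_0: "complexify {0::'v} = {0}"
      by (auto simp: complexify_def zero_prod_def)
    consider "q < 0" | "q = 0" | "q = 1" | "q > 1"
      by linarith
    then have "complexify (M (2 * q)) \<subseteq> F q + complexify (M (2 * q - 1)) \<and>
      F (q + 1) \<inter> complexify (M (2 * q)) \<subseteq> complexify (M (2 * q - 1))"
    proof cases
      case 1
      then have "M (2 * q) = {0}" "M (2 * q - 1) = {0}"
        by (simp_all add: M_def square_zero_weight_def)
      then show ?thesis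
        using plus_F by auto
    next
      case 2
      then have "M (2 * q) = L" "M (2 * q - 1) = {0}"
        by (simp_all add: M_def square_zero_weight_def)
      moreover have "z \<in> UNIV + {0}" for z :: "'v \<times> 'v"
        using set_plus_intro[of z UNIV 0 "{0}"] by simp
      ultimately show ?thesis
        using 2 F1 F_low[of 0] E_L complexify_0 by auto
    next
      case 3
      then have "M (2 * q) = UNIV" "M (2 * q - 1) = L"
        by (simp_all add: M_def square_zero_weight_def)
      moreover have "0 \<in> complexify L"
        by (rule subspace_0[OF subspace_complexify[OF L]])
      ultimately show ?thesis
        using 3 F1 F_high[of 2] E_plus_L by auto
    next
      case 4
      then have "M (2 * q) = UNIV" "M (2 * q - 1) = UNIV"
        by (simp_all add: M_def square_zero_weight_def)
      then show ?thesis
        using plus_F by auto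
    qed
    then show "complexify (M (2 * q)) \<subseteq> F q + complexify (M (2 * q - 1))"
      "F (q + 1) \<inter> complexify (M (2 * q)) \<subseteq> complexify (M (2 * q - 1))"
      by auto
  qed
  have mixed: "mixed_hodge_structure (M l) (restrict_fil F (complexify (M l))) (restrict_fil M (M l))"
    for l
    using HT by (intro hodge_tate_imp_mixed_hodge hodge_tate_restrict)

  define Ws where "Ws = (\<lambda>j::nat. if j = 0 then W else M)"
  have Ws_step: "\<exists>l'. Ws k l = M l'" for k l
    using W_step by (auto simp: Ws_def)
  have F_shift: "map_prod (?N j) (?N j) ` F p \<subseteq> F (p - 1)" for j p
  proof (cases "p \<le> 1")
    case True
    then show ?thesis
      using F_low[of "p - 1"] by simp
  next
    case False
    have "0 \<in> F (p - 1)"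
      using assms(16) cx.subspace_0[of "F (p - 1)"] by (simp add: decreasing_filtration_def)
    with False show ?thesis
      using F_high[of p] linear_0[OF lin[of j]] by (simp add: zero_prod_def)
  qed
  show ?thesis
    unfolding deligne_hodge_system_def
  proof (intro conjI exI[of _ Ws])
    show "\<exists>B::'v set. finite B \<and> span B = UNIV"
      by (intro exI[of _ "{e1, f1, e2, f2}"]) (simp add: assms(3))
    show "\<forall>i\<in>{1..2}. \<forall>j\<in>{1..2}. ?N i \<circ> ?N j = ?N j \<circ> ?N i"
      by (intro ballI ext) (simp only: comp_apply NN)
    show "\<forall>j\<in>{1..2}. linear (?N j) \<and> (\<exists>n. \<forall>x. (?N j ^^ n) x = 0) \<and> (\<forall>l. ?N j ` W l \<subseteq> W l)"
      by (intro ballI conjI allI lin nil keepW)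
    show "\<forall>j\<in>{1..2}. is_relative_weight_filtration UNIV (?N j) (Ws (j - 1)) (Ws j)"
    proof
      show "is_relative_weight_filtration UNIV (?N j) (Ws (j - 1)) (Ws j)" if "j \<in> {1..2}" for j
        using that step1 step2 by (cases "j = 1") (simp_all add: Ws_def)
    qed
    show "\<forall>j\<in>{1..2}. \<forall>k l. k + 1 < j \<longrightarrow> is_relative_weight_filtration (Ws k l) (?N j)
        (restrict_fil (Ws (j - 1)) (Ws k l)) (restrict_fil (Ws j) (Ws k l))"
    proof (intro ballI allI impI)
      fix j k :: nat and l
      assume "j \<in> {1..2}" "k + 1 < j"
      then have "j = 2"
        by auto
      moreover obtain l' where "Ws k l = M l'"
        using Ws_step by blast
      ultimately show "is_relative_weight_filtration (Ws k l) (?N j)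
          (restrict_fil (Ws (j - 1)) (Ws k l)) (restrict_fil (Ws j) (Ws k l))"
        using step2_restrict[of l'] by (simp add: Ws_def)
    qed
    show "\<forall>j\<in>{1..2}. \<forall>k\<in>{0..2}. \<forall>l. ?N j ` Ws k l \<subseteq> Ws k l"
      unfolding Ws_def by (intro ballI allI) (simp only: keepW keepM simp_thms split: if_split)
    show "\<forall>j\<in>{1..2}. \<forall>k\<in>{0..2}. \<forall>l. j \<le> k \<longrightarrow> ?N j ` Ws k l \<subseteq> Ws k (l - 2)"
    proof (intro ballI allI impI)
      fix j k :: nat and l
      assume "j \<in> {1..2}" "j \<le> k"
      then have "Ws k = M"
        by (simp add: Ws_def)
      then show "?N j ` Ws k l \<subseteq> Ws k (l - 2)"
        using lowerM by simp
    qed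
    show "\<forall>j\<in>{1..2}. \<forall>p. map_prod (?N j) (?N j) ` F p \<subseteq> F (p - 1)"
      using F_shift by blast
    show "mixed_hodge_structure UNIV F (Ws 2)"
      using hodge_tate_imp_mixed_hodge[OF HT] by (simp add: Ws_def)
    show "\<forall>k<2. \<forall>l. mixed_hodge_structure (Ws k l)
        (restrict_fil F (complexify (Ws k l))) (restrict_fil (Ws 2) (Ws k l))"
    proof (intro allI impI)
      fix k l
      obtain l' where "Ws k l = M l'"
        using Ws_step by blast
      then show "mixed_hodge_structure (Ws k l)
          (restrict_fil F (complexify (Ws k l))) (restrict_fil (Ws 2) (Ws k l))"
        using mixed[of l'] by (simp add: Ws_def)
    qed
  qed (use assms(14,16) in \<open>simp_all add: Ws_def\<close>)
qed

end
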